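(* Let $\mathcal{F}: H \to \mathbb{R}$ be a free energy functional that admits a proper convex splitting $\mathcal{F} = \mathcal{F}_c - \mathcal{F}_e$, i.e. $\mathcal{F}_c,\mathcal{F}_e : H \to \mathbb{R}$ are functionals such that $$\frac{d^2}{d\epsilon^2}\mathcal{F}_\alpha[\rho+\epsilon v] \ge 0 \qquad \forall \rho, v\in H,\ \epsilon\in\mathbb{R},\ \alpha\in\{c,e\}.$$ Then for all $\phi,\psi\in H$ $$\mathcal{F}[\phi]-\mathcal{F}[\psi] \le \left(\delta_\phi \mathcal{F}_c[\phi]-\delta_\psi\mathcal{F}_e[\psi],\ \phi-\psi\right)_2 .$$
   Context: $\Omega=[0,L_x)\times[0,L_y)$ with periodic boundary conditions. $H\subset L^2_{per}(\Omega)$ is a Hilbert space of sufficiently regular $\Omega$-periodic functions $\rho:\Omega\to\mathbb{R}$. $(\cdot,\cdot)_2$ is the usual $L^2(\Omega)$ inner product. The variational derivative $\delta_\psi \mathcal{G}[\psi]$ (also written $\delta_\rho\mathcal{G}$ evaluated at $\psi$) of a functional $\mathcal{G}$ on $H$ is defined by $\lim_{\epsilon\to 0}\frac{d}{d\epsilon}\mathcal{G}[\psi+\epsilon v]=(\delta_\psi \mathcal{G}[\psi],v)_2$ for all $v\in H$; the functionals are assumed regular enough that these derivatives, and the second derivatives in $\epsilon$, exist. *)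

theory Defs
  imports "HOL-Analysis.Analysis"
begin

text \<open>
  \<open>\<Omega>\<close>-periodic functions are modelled as doubly periodic functions on the whole plane, and
  elements of $L^2$ as functions rather than as classes modulo equality almost everywhere.
  A functional on classes is in particular a functional on representatives.
\<close>

definition period_cell :: "real \<Rightarrow> real \<Rightarrow> (real \<times> real) set" where
  "period_cell Lx Ly = {0..<Lx} \<times> {0..<Ly}"

definition periodic_fun2 :: "real \<Rightarrow> real \<Rightarrow> (real \<times> real \<Rightarrow> real) \<Rightarrow> bool" where
  "periodic_fun2 Lx Ly f \<longleftrightarrow> (\<forall>x y. f (x + Lx, y) = f (x, y) \<and> f (x, y + Ly) = f (x, y))"

definition L2_per :: "real \<Rightarrow> real \<Rightarrow> (real \<times> real \<Rightarrow> real) set" where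
  "L2_per Lx Ly = {f. periodic_fun2 Lx Ly f \<and> f \<in> borel_measurable lebesgue \<and>
     set_integrable lebesgue (period_cell Lx Ly) (\<lambda>x. (f x)\<^sup>2)}"

definition L2_inner ::
  "real \<Rightarrow> real \<Rightarrow> (real \<times> real \<Rightarrow> real) \<Rightarrow> (real \<times> real \<Rightarrow> real) \<Rightarrow> real" where
  "L2_inner Lx Ly f g = set_lebesgue_integral lebesgue (period_cell Lx Ly) (\<lambda>x. f x * g x)"

text \<open>
  The inner product \<open>ip\<close> of \<open>H\<close> (for instance a Sobolev inner product) need not be that of $L^2$.
  Definiteness is required modulo equality almost everywhere, as \<open>H\<close> consists of representatives.
\<close>

locale periodic_hilbert_space =
  fixes Lx Ly :: real
    and H :: "(real \<times> real \<Rightarrow> real) set"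
    and ip :: "(real \<times> real \<Rightarrow> real) \<Rightarrow> (real \<times> real \<Rightarrow> real) \<Rightarrow> real"
  assumes Lx_pos: "0 < Lx" and Ly_pos: "0 < Ly"
    and subset_L2: "H \<subseteq> L2_per Lx Ly"
    and zero_mem: "(\<lambda>x. 0) \<in> H"
    and add_mem: "\<And>f g. f \<in> H \<Longrightarrow> g \<in> H \<Longrightarrow> (\<lambda>x. f x + g x) \<in> H"
    and scale_mem: "\<And>c f. f \<in> H \<Longrightarrow> (\<lambda>x. c * f x) \<in> H"
    and ip_commute: "\<And>f g. f \<in> H \<Longrightarrow> g \<in> H \<Longrightarrow> ip f g = ip g f"
    and ip_add: "\<And>f g h. f \<in> H \<Longrightarrow> g \<in> H \<Longrightarrow> h \<in> H \<Longrightarrow>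
                   ip (\<lambda>x. f x + g x) h = ip f h + ip g h"
    and ip_scale: "\<And>c f g. f \<in> H \<Longrightarrow> g \<in> H \<Longrightarrow> ip (\<lambda>x. c * f x) g = c * ip f g"
    and ip_nonneg: "\<And>f. f \<in> H \<Longrightarrow> 0 \<le> ip f f"
    and ip_eq_0_iff: "\<And>f. f \<in> H \<Longrightarrow> ip f f = 0 \<longleftrightarrow> (AE x in lebesgue. f x = 0)"
    and ip_complete: "\<And>X :: nat \<Rightarrow> real \<times> real \<Rightarrow> real. (\<And>n. X n \<in> H) \<Longrightarrow>
          (\<And>e. 0 < e \<Longrightarrow> \<exists>N. \<forall>m\<ge>N. \<forall>n\<ge>N.
              sqrt (ip (\<lambda>x. X m x - X n x) (\<lambda>x. X m x - X n x)) < e) \<Longrightarrow>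
          \<exists>f\<in>H. (\<lambda>n. sqrt (ip (\<lambda>x. X n x - f x) (\<lambda>x. X n x - f x))) \<longlonglongrightarrow> 0"

definition along_line ::
  "((real \<times> real \<Rightarrow> real) \<Rightarrow> real) \<Rightarrow> (real \<times> real \<Rightarrow> real) \<Rightarrow> (real \<times> real \<Rightarrow> real) \<Rightarrow> real \<Rightarrow> real" where
  "along_line G \<rho> v \<epsilon> = G (\<lambda>x. \<rho> x + \<epsilon> * v x)"

text \<open>
  A relation rather than an operator: unless \<open>H\<close> is dense in $L^2$, a variational derivative is
  only determined up to its pairing with \<open>H\<close>.
\<close>

definition has_variational_derivative ::
  "real \<Rightarrow> real \<Rightarrow> (real \<times> real \<Rightarrow> real) set \<Rightarrow> ((real \<times> real \<Rightarrow> real) \<Rightarrow> real) \<Rightarrow>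
   (real \<times> real \<Rightarrow> real) \<Rightarrow> (real \<times> real \<Rightarrow> real) \<Rightarrow> bool" where
  "has_variational_derivative Lx Ly H G \<psi> g \<longleftrightarrow> g \<in> L2_per Lx Ly \<and>
     (\<forall>v\<in>H. (\<forall>\<^sub>F \<epsilon> in nhds 0. along_line G \<psi> v differentiable at \<epsilon>) \<and>
        ((\<lambda>\<epsilon>. deriv (along_line G \<psi> v) \<epsilon>) \<longlongrightarrow> L2_inner Lx Ly g v) (at 0))"

definition twice_differentiable_along_lines ::
  "(real \<times> real \<Rightarrow> real) set \<Rightarrow> ((real \<times> real \<Rightarrow> real) \<Rightarrow> real) \<Rightarrow> bool" where
  "twice_differentiable_along_lines H G \<longleftrightarrow> (\<forall>\<rho>\<in>H. \<forall>v\<in>H. \<forall>\<epsilon>.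
     along_line G \<rho> v differentiable at \<epsilon> \<and> deriv (along_line G \<rho> v) differentiable at \<epsilon>)"

definition proper_convex_splitting ::
  "(real \<times> real \<Rightarrow> real) set \<Rightarrow> ((real \<times> real \<Rightarrow> real) \<Rightarrow> real) \<Rightarrow>
   ((real \<times> real \<Rightarrow> real) \<Rightarrow> real) \<Rightarrow> ((real \<times> real \<Rightarrow> real) \<Rightarrow> real) \<Rightarrow> bool" where
  "proper_convex_splitting H F Fc Fe \<longleftrightarrow>
     (\<forall>\<rho>\<in>H. F \<rho> = Fc \<rho> - Fe \<rho>) \<and>
     (\<forall>G\<in>{Fc, Fe}. \<forall>\<rho>\<in>H. \<forall>v\<in>H. \<forall>\<epsilon>. (deriv ^^ 2) (along_line G \<rho> v) \<epsilon> \<ge> 0)"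

end

theory Submission
  imports Defs
begin

text \<open>
  A functional that is convex along lines lies above its tangents:
  \<open>G[\<eta>] - G[\<psi>] \<ge> (\<delta>G[\<psi>], \<eta> - \<psi>)\<close>. Apply this to \<open>Fc\<close> with tangent at \<open>\<phi>\<close> and to \<open>Fe\<close> with
  tangent at \<open>\<psi>\<close>, and subtract.
\<close>

lemma period_cell_sets_lebesgue: "period_cell Lx Ly \<in> sets lebesgue"
proof -
  have "period_cell Lx Ly \<in> sets borel"
    unfolding period_cell_def by (intro borel_Times) auto
  then show ?thesis
    by simp
qed

text \<open>The product is dominated by the sum of the two squares, both integrable over the cell:
  2|a||b| \<le> a^2 + b^2, and dropping the factor 2 is harmless since |ab| \<ge> 0.\<close>

lemma L2_per_set_integrable_mult:
  assumes f: "f \<in> L2_per Lx Ly" and g: "g \<in> L2_per Lx Ly"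
  shows "set_integrable lebesgue (period_cell Lx Ly) (\<lambda>x. f x * g x)"
proof (rule set_integrable_bound)
  show "set_integrable lebesgue (period_cell Lx Ly) (\<lambda>x. (f x)\<^sup>2 + (g x)\<^sup>2)"
    using f g by (intro set_integral_add) (auto simp: L2_per_def)
  have [measurable]: "f \<in> borel_measurable lebesgue" "g \<in> borel_measurable lebesgue"
    using f g by (auto simp: L2_per_def)
  have [measurable]: "period_cell Lx Ly \<in> sets lebesgue"
    by (rule period_cell_sets_lebesgue)
  show "set_borel_measurable lebesgue (period_cell Lx Ly) (\<lambda>x. f x * g x)"
    unfolding set_borel_measurable_def by measurable
  have "\<bar>a * b\<bar> \<le> a\<^sup>2 + b\<^sup>2" for a b :: real
    using sum_squares_bound[of "\<bar>a\<bar>" "\<bar>b\<bar>"] abs_ge_zero[of "a * b"]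
    unfolding abs_mult power2_abs by linarith
  then show "AE x in lebesgue. x \<in> period_cell Lx Ly \<longrightarrow>
      norm (f x * g x) \<le> norm ((f x)\<^sup>2 + (g x)\<^sup>2)"
    by simp
qed

text \<open>Square integrability of all three functions enters because the integral of a difference
  splits only when both products are integrable.\<close>

lemma L2_inner_diff_left:
  assumes "f \<in> L2_per Lx Ly" "g \<in> L2_per Lx Ly" "h \<in> L2_per Lx Ly"
  shows "L2_inner Lx Ly (\<lambda>x. f x - g x) h = L2_inner Lx Ly f h - L2_inner Lx Ly g h"
  unfolding L2_inner_def left_diff_distrib
  by (intro set_integral_diff(2) L2_per_set_integrable_mult assms)

text \<open>No membership in \<open>L2_per\<close> is assumed: the Bochner integral commutes with
  negation unconditionally, as both sides default to 0 when the product is not integrable.\<close>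

lemma L2_inner_minus_diff_right:
  "L2_inner Lx Ly f (\<lambda>x. g x - h x) = - L2_inner Lx Ly f (\<lambda>x. h x - g x)"
proof -
  have "f x * (g x - h x) = - (f x * (h x - g x))" for x
    by (simp add: algebra_simps)
  then show ?thesis
    by (simp only: L2_inner_def set_lebesgue_integral_def scaleR_minus_right integral_minus)
qed

lemma (in periodic_hilbert_space) diff_mem:
  assumes "f \<in> H" "g \<in> H"
  shows "(\<lambda>x. f x - g x) \<in> H"
  using add_mem[OF assms(1) scale_mem[OF assms(2), of "-1"]] by simp

text \<open>By the mean value theorem, \<open>h 1 - h 0\<close> is the slope at some z in (0, 1). A
  nonnegative second derivative makes the slope nondecreasing, so the slope at z is at least the
  slope at 0.\<close>

lemma above_tangent_at_0:
  fixes h :: "real \<Rightarrow> real"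
  assumes h: "\<And>t. h differentiable at t" and h': "\<And>t. deriv h differentiable at t"
    and convex: "\<And>t. 0 \<le> (deriv ^^ 2) h t"
  shows "h 0 + deriv h 0 \<le> h 1"
proof -
  have "(h has_real_derivative deriv h t) (at t)" for t
    using h by (simp add: DERIV_deriv_iff_real_differentiable)
  then obtain z where z: "0 < z" "h 1 - h 0 = (1 - 0) * deriv h z"
    using MVT2[of 0 1 h "deriv h"] by auto
  have "(deriv h has_real_derivative (deriv ^^ 2) h t) (at t)" for t
    using h' by (simp add: DERIV_deriv_iff_real_differentiable numeral_2_eq_2)
  then have "deriv h 0 \<le> deriv h z"
    using convex less_imp_le[OF z(1)] by (blast intro: DERIV_nonneg_imp_nondecreasing)
  with z(2) show ?thesis
    by simp
qed

lemma (in periodic_hilbert_space) variational_derivative_above_tangent: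
  assumes deriv: "has_variational_derivative Lx Ly H G \<psi> g"
    and diff: "twice_differentiable_along_lines H G"
    and convex: "\<And>\<rho> v \<epsilon>. \<rho> \<in> H \<Longrightarrow> v \<in> H \<Longrightarrow> 0 \<le> (deriv ^^ 2) (along_line G \<rho> v) \<epsilon>"
    and \<psi>: "\<psi> \<in> H" and \<eta>: "\<eta> \<in> H"
  shows "G \<psi> + L2_inner Lx Ly g (\<lambda>x. \<eta> x - \<psi> x) \<le> G \<eta>"
proof -
  define v where "v = (\<lambda>x. \<eta> x - \<psi> x)"
  \<comment> \<open>Restricting \<open>G\<close> to the line through \<psi> and \<eta> reduces the
    claim to one real variable: \<open>h 0\<close> is \<open>G \<psi>\<close> and \<open>h 1\<close>
    is \<open>G \<eta>\<close>.\<close>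
  define h where "h = along_line G \<psi> v"
  have v: "v \<in> H"
    unfolding v_def using \<eta> \<psi> by (rule diff_mem)
  have h: "h differentiable at t" and h': "deriv h differentiable at t" for t
    using diff \<psi> v by (auto simp: twice_differentiable_along_lines_def h_def)
  \<comment> \<open>The variational derivative gives only a limit of slopes over a punctured
    neighbourhood of 0. As \<open>deriv h\<close> is itself differentiable, it is continuous at 0,
    so uniqueness of limits identifies this limit with \<open>deriv h 0\<close>.\<close>
  have "(deriv h \<longlongrightarrow> L2_inner Lx Ly g v) (at 0)"
    using deriv v by (simp add: has_variational_derivative_def h_def)
  moreover have "(deriv h \<longlongrightarrow> deriv h 0) (at 0)"
    using differentiable_imp_continuous_within[OF h'[of 0]] by (simp add: continuous_within)
  ultimately have "deriv h 0 = L2_inner Lx Ly g v"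
    by (rule tendsto_unique[OF trivial_limit_at, rotated])
  moreover have "h 0 + deriv h 0 \<le> h 1"
    using h h' convex[OF \<psi> v] by (intro above_tangent_at_0) (auto simp: h_def)
  ultimately show ?thesis
    by (simp add: h_def along_line_def v_def)
qed

theorem theorem3p4:
  fixes Lx Ly :: real
    and H :: "(real \<times> real \<Rightarrow> real) set"
    and ip :: "(real \<times> real \<Rightarrow> real) \<Rightarrow> (real \<times> real \<Rightarrow> real) \<Rightarrow> real"
    and F Fc Fe :: "(real \<times> real \<Rightarrow> real) \<Rightarrow> real"
    and dFc dFe :: "(real \<times> real \<Rightarrow> real) \<Rightarrow> (real \<times> real \<Rightarrow> real)"
  assumes "periodic_hilbert_space Lx Ly H ip"
    and "\<forall>\<rho>\<in>H. has_variational_derivative Lx Ly H Fc \<rho> (dFc \<rho>)"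
    and "\<forall>\<rho>\<in>H. has_variational_derivative Lx Ly H Fe \<rho> (dFe \<rho>)"
    and "twice_differentiable_along_lines H Fc"
    and "twice_differentiable_along_lines H Fe"
    and "proper_convex_splitting H F Fc Fe"
  shows "\<forall>\<phi>\<in>H. \<forall>\<psi>\<in>H.
    F \<phi> - F \<psi> \<le> L2_inner Lx Ly (\<lambda>x. dFc \<phi> x - dFe \<psi> x) (\<lambda>x. \<phi> x - \<psi> x)"
proof (intro ballI)
  fix \<phi> \<psi>
  assume \<phi>: "\<phi> \<in> H" and \<psi>: "\<psi> \<in> H"
  interpret periodic_hilbert_space Lx Ly H ip
    by fact
  define v where "v = (\<lambda>x. \<phi> x - \<psi> x)"
  have convex: "0 \<le> (deriv ^^ 2) (along_line G \<rho> w) \<epsilon>"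
    if "G \<in> {Fc, Fe}" "\<rho> \<in> H" "w \<in> H" for G \<rho> w \<epsilon>
    using assms(6) that unfolding proper_convex_splitting_def by blast
  \<comment> \<open>The tangent at \<phi> is evaluated at \<psi>, so its direction is
    \<open>-v\<close>; flipping the sign turns this lower bound for \<open>Fc \<psi>\<close> into an
    upper bound for \<open>Fc \<phi> - Fc \<psi>\<close>.\<close>
  have "Fc \<phi> + L2_inner Lx Ly (dFc \<phi>) (\<lambda>x. \<psi> x - \<phi> x) \<le> Fc \<psi>"
    using assms(2) \<phi> by (intro variational_derivative_above_tangent[OF _ assms(4) convex \<phi> \<psi>]) auto
  then have c: "Fc \<phi> - L2_inner Lx Ly (dFc \<phi>) v \<le> Fc \<psi>"
    unfolding v_def L2_inner_minus_diff_right[of _ _ _ \<psi> \<phi>] by simp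
  have e: "Fe \<psi> + L2_inner Lx Ly (dFe \<psi>) v \<le> Fe \<phi>"
    unfolding v_def using assms(3) \<psi>
    by (intro variational_derivative_above_tangent[OF _ assms(5) convex \<psi> \<phi>]) auto
  have "dFc \<phi> \<in> L2_per Lx Ly" "dFe \<psi> \<in> L2_per Lx Ly"
    using assms(2,3) \<phi> \<psi> unfolding has_variational_derivative_def by blast+
  moreover have "v \<in> L2_per Lx Ly"
    unfolding v_def using diff_mem[OF \<phi> \<psi>] subset_L2 by blast
  ultimately have "L2_inner Lx Ly (\<lambda>x. dFc \<phi> x - dFe \<psi> x) v
      = L2_inner Lx Ly (dFc \<phi>) v - L2_inner Lx Ly (dFe \<psi>) v"
    by (rule L2_inner_diff_left)
  moreover have "F \<phi> = Fc \<phi> - Fe \<phi>" "F \<psi> = Fc \<psi> - Fe \<psi>"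
    using assms(6) \<phi> \<psi> unfolding proper_convex_splitting_def by blast+
  ultimately show "F \<phi> - F \<psi> \<le> L2_inner Lx Ly (\<lambda>x. dFc \<phi> x - dFe \<psi> x) (\<lambda>x. \<phi> x - \<psi> x)"
    using c e unfolding v_def by linarith
qed

end
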